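(* Let $G$ be a graph on $n$ vertices, let $A,B\subseteq V(G)$, let $\mathcal F$ be a set of cliques of $G$, and let $f$ be a positive real. Then either there exists an $(A,B)$-separator $X$ in $G$ with $\rho^*_{G,\mathcal F}(X)\le(8+4\ln n)f$, or there exists a collection $P_1,\dots,P_{\lceil f\log|\mathcal F|\rceil}$ of $A$-$B$ paths in $G$ such that no clique in $\mathcal F$ intersects at least $6\log|\mathcal F|$ of these paths.
   Context: An $(A,B)$-separator in $G$ is a set $X\subseteq V(G)$ such that every path from a vertex of $A$ to a vertex of $B$ contains a vertex of $X$. An $A$-$B$ path is a path with one endpoint in $A$ and the other in $B$. For $X\subseteq V(G)$, $\rho^*_{G,\mathcal F}(X)$ is the minimum of $\sum_{K\in\mathcal F}\gamma(K)$ over all $\gamma:\mathcal F\to[0,1]$ with $\sum_{K\in\mathcal F,\,v\in K}\gamma(K)\ge1$ for every $v\in X$ (and $\infty$ if no such $\gamma$ exists). $\log$ denotes the base-2 logarithm and $\ln$ the natural logarithm.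
   Formalization: The case |F| = 1 is excluded: there log|F| = 0, so the second alternative cannot hold, and the claim fails for G a single vertex v, A = B = {v}, F = {{v}}, f = 1/100. *)

theory Defs
  imports "Graph_Theory.Graph_Theory" "HOL-Library.Extended_Real"
begin

text \<open>
  A finite simple graph is a digraph satisfying the library locale \<open>graph\<close>: finite, loop-free,
  without parallel arcs, and with symmetric adjacency \<open>u \<rightarrow>\<^bsub>G\<^esub> v\<close>.
\<close>

definition clique :: "('a, 'b) pre_digraph \<Rightarrow> 'a set \<Rightarrow> bool" where
  "clique G K \<longleftrightarrow> K \<subseteq> verts G \<and> (\<forall>u\<in>K. \<forall>v\<in>K. u \<noteq> v \<longrightarrow> u \<rightarrow>\<^bsub>G\<^esub> v)"

text \<open>
  A path is given by its nonempty list of pairwise distinct vertices, listed from the endpoint in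
  \<open>A\<close> to the endpoint in \<open>B\<close>. A single vertex of \<open>A \<inter> B\<close> is such a path.
\<close>

definition AB_path :: "('a, 'b) pre_digraph \<Rightarrow> 'a set \<Rightarrow> 'a set \<Rightarrow> 'a vwalk \<Rightarrow> bool" where
  "AB_path G A B p \<longleftrightarrow> vpath p G \<and> hd p \<in> A \<and> last p \<in> B"

definition AB_separator :: "('a, 'b) pre_digraph \<Rightarrow> 'a set \<Rightarrow> 'a set \<Rightarrow> 'a set \<Rightarrow> bool" where
  "AB_separator G A B X \<longleftrightarrow> X \<subseteq> verts G \<and> (\<forall>p. AB_path G A B p \<longrightarrow> set p \<inter> X \<noteq> {})"

definition fractional_cover :: "'a set set \<Rightarrow> 'a set \<Rightarrow> ('a set \<Rightarrow> real) \<Rightarrow> bool" where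
  "fractional_cover F X \<gamma> \<longleftrightarrow>
     (\<forall>K\<in>F. \<gamma> K \<in> {0..1}) \<and> (\<forall>v\<in>X. 1 \<le> (\<Sum>K | K \<in> F \<and> v \<in> K. \<gamma> K))"

text \<open>
  For finite \<open>F\<close> (in particular for any set of cliques of a finite graph) the infimum is over the
  values of a linear program on a compact polytope, so it is a minimum whenever a cover exists;
  otherwise it is the infimum of the empty set, which is \<open>\<infinity>\<close>.
\<close>

definition rho_star :: "'a set set \<Rightarrow> 'a set \<Rightarrow> ereal" where
  "rho_star F X = Inf {ereal (\<Sum>K\<in>F. \<gamma> K) | \<gamma>. fractional_cover F X \<gamma>}"

end

theory Submission
  imports Defs
begin

text \<open>
  Multiplicative weights replace linear programming duality. If for every positive weighting of
  \<open>F\<close> some \<open>A\<close>-\<open>B\<close> path meets at most a \<open>1/f\<close> fraction of the weight, then choosing such paths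
  greedily, each time doubling the weights of the cliques met, keeps the total weight below
  \<open>card F * (1 + 1/f) ^ N\<close>, so no clique is met too often. Otherwise a bad weighting, scaled to
  total mass \<open>f\<close>, gives every \<open>A\<close>-\<open>B\<close> path hit weight at least \<open>1\<close>. Let \<open>\<omega> v\<close> be the mass of the
  cliques through \<open>v\<close>, and let \<open>d\<close> be the \<open>\<omega>\<close>-distance from \<open>A\<close>. For each threshold \<open>\<theta>\<close>, the
  vertices \<open>v\<close> with \<open>\<theta> \<in> (d v - \<omega> v, d v]\<close> form a separator. Over a clique all these intervals share
  (up to closure) the point \<open>m = min d\<close>, so those containing \<open>\<theta>\<close> have length at least
  \<open>\<bar>\<theta> - m\<bar>\<close>. Scaling the mass of each clique by \<open>1 / \<bar>\<theta> - m\<bar>\<close> therefore covers the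
  separator, and averaging over \<open>\<theta>\<close> costs only a logarithm.
\<close>

section \<open>Multiplicative weights and the load bound\<close>

text \<open>The weight of \<open>K\<close> is 2 to the power of its current load, so the hit weight
  that \<open>ex\<close> bounds by a \<open>1 / f\<close> share is exactly the increase of the
  total.\<close>

lemma greedy_balanced_sequence:
  fixes hit :: "'p \<Rightarrow> 'k \<Rightarrow> bool" and f :: real
  assumes "finite F" and f: "f > 0"
    and ex: "\<And>w. (\<And>K. K \<in> F \<Longrightarrow> w K > 0) \<Longrightarrow>
      \<exists>p. Q p \<and> f * (\<Sum>K\<in>{K\<in>F. hit p K}. w K) \<le> (\<Sum>K\<in>F. w K)"
  shows "\<exists>P. (\<forall>i\<in>{1..N}. Q (P i)) \<and>
    (\<Sum>K\<in>F. (2::real) ^ card {i\<in>{1..N}. hit (P i) K}) \<le> real (card F) * (1 + 1 / f) ^ N"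
proof (induction N)
  case 0
  then show ?case by simp
next
  case (Suc N)
  then obtain P where PQ: "\<And>i. i \<in> {1..N} \<Longrightarrow> Q (P i)"
    and P: "(\<Sum>K\<in>F. (2::real) ^ card {i\<in>{1..N}. hit (P i) K}) \<le> real (card F) * (1 + 1 / f) ^ N"
    by blast
  define w where "w K = (2::real) ^ card {i\<in>{1..N}. hit (P i) K}" for K
  obtain p where "Q p" and p: "f * (\<Sum>K\<in>{K\<in>F. hit p K}. w K) \<le> (\<Sum>K\<in>F. w K)"
    using ex[of w] by (auto simp: w_def)
  define P' where "P' = P(Suc N := p)"
  have load: "(2::real) ^ card {i\<in>{1..Suc N}. hit (P' i) K} = w K + (if hit p K then w K else 0)" for K
  proof -
    have "{i\<in>{1..Suc N}. hit (P' i) K} =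
        (if hit p K then insert (Suc N) {i\<in>{1..N}. hit (P i) K} else {i\<in>{1..N}. hit (P i) K})"
      by (auto simp: P'_def le_Suc_eq)
    then show ?thesis by (simp add: w_def)
  qed
  have "(\<Sum>K\<in>F. (2::real) ^ card {i\<in>{1..Suc N}. hit (P' i) K})
      = (\<Sum>K\<in>F. w K) + (\<Sum>K\<in>{K\<in>F. hit p K}. w K)"
    unfolding load sum.distrib using \<open>finite F\<close> by (simp add: sum.inter_filter)
  also have "\<dots> \<le> (\<Sum>K\<in>F. w K) * (1 + 1 / f)"
    using p f by (simp add: field_simps)
  also have "\<dots> \<le> real (card F) * (1 + 1 / f) ^ N * (1 + 1 / f)"
    using P f by (intro mult_right_mono) (auto simp: w_def)
  finally have "(\<Sum>K\<in>F. (2::real) ^ card {i\<in>{1..Suc N}. hit (P' i) K}) \<le> real (card F) * (1 + 1 / f) ^ Suc N"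
    by (simp add: mult_ac)
  moreover have "\<forall>i\<in>{1..Suc N}. Q (P' i)"
    using PQ \<open>Q p\<close> by (auto simp: P'_def le_Suc_eq)
  ultimately show ?case by blast
qed

text \<open>Write \<open>L\<close> for \<open>log 2 k\<close>. For \<open>f < 1\<close> the number
  of paths is already below \<open>L + 1\<close>. For \<open>f \<ge> 1\<close> the load is bounded
  by taking logarithms in \<open>pot\<close>, using
  \<open>1 + 1 / f \<le> exp (1 / f)\<close>.\<close>

lemma load_less_of_potential:
  fixes f :: real
  assumes "f > 0" and k: "k \<ge> (2::nat)" and N: "N = nat \<lceil>f * log 2 (real k)\<rceil>"
    and "m \<le> N" and pot: "(2::real) ^ m \<le> real k * (1 + 1 / f) ^ N"
  shows "real m < 6 * log 2 (real k)"
proof -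
  define L where "L = log 2 (real k)"
  have L: "L \<ge> 1" and kL: "real k = 2 powr L"
    using k by (simp_all add: L_def)
  have "0 \<le> f * L"
    using \<open>f > 0\<close> L by simp
  then have NL: "real N < f * L + 1"
    unfolding N L_def by linarith
  show ?thesis
  proof (cases "f \<ge> 1")
    case False
    with L have "f * L \<le> L" by (simp add: mult_left_le_one_le \<open>f > 0\<close> less_imp_le)
    moreover have "real m \<le> real N" using \<open>m \<le> N\<close> by simp
    ultimately have "real m < 6 * L" using NL L by linarith
    then show ?thesis by (simp add: L_def)
  next
    case True
    have e: "(1 + 1 / f) \<le> exp (1 / f)"
      by (rule exp_ge_add_one_self)
    have "2 powr m \<le> 2 powr L * (1 + 1 / f) ^ N"
      using pot kL by (simp add: powr_realpow)
    also have "\<dots> \<le> 2 powr L * exp (1 / f) ^ N"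
      using e \<open>f > 0\<close> by (intro mult_left_mono power_mono) auto
    also have "\<dots> = exp (L * ln 2 + real N / f)"
      by (simp add: powr_def exp_add exp_of_nat_mult[symmetric])
    finally have "real m * ln 2 \<le> L * ln 2 + real N / f"
      by (simp add: powr_def)
    \<comment> \<open>Since \<open>f \<ge> 1\<close>, the rounding error of the ceiling is at most
      \<open>f\<close>.\<close>
    also have "real N / f \<le> L + 1"
    proof -
      have "real N \<le> f * (L + 1)"
        using NL True by (simp add: algebra_simps)
      then show ?thesis
        using \<open>f > 0\<close> by (simp add: field_simps)
    qed
    \<comment> \<open>The constant 6 is 1 + 5: from \<open>ln 2 \<ge> 1 / 2\<close> and
      \<open>L \<ge> 1\<close>, five copies of \<open>L * ln 2\<close> exceed
      \<open>L + 1\<close>.\<close>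
    also have "L * ln 2 + (L + 1) < L * ln 2 + 5 * (L * ln 2)"
    proof -
      have "ln (1 / 2 :: real) \<le> 1 / 2 - 1"
        by (rule ln_le_minus_one) simp
      then have "ln 2 \<ge> (1 / 2 :: real)"
        by (simp add: ln_div)
      then have "L * (5 * (1 / 2)) \<le> L * (5 * ln 2)"
        using L by (intro mult_left_mono) linarith+
      also have "\<dots> = 5 * (L * ln 2)" by (simp only: mult_ac)
      finally show ?thesis using L by linarith
    qed
    finally have "real m * ln 2 < (6 * L) * ln 2" by simp
    then show ?thesis
      by (simp add: L_def[symmetric])
  qed
qed

section \<open>Averaging over thresholds\<close>

text \<open>The antiderivative of \<open>1 / (\<bar>t\<bar> + e)\<close> that vanishes at 0, for
  positive \<open>e\<close>.\<close>

definition signed_log :: "real \<Rightarrow> real \<Rightarrow> real" where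
  "signed_log e t = (if t \<ge> 0 then ln (1 + t / e) else - ln (1 - t / e))"

lemma DERIV_signed_log:
  assumes "e > 0"
  shows "(signed_log e has_real_derivative 1 / (\<bar>t\<bar> + e)) (at t)"
proof -
  have right: "(signed_log e has_real_derivative 1 / (\<bar>t\<bar> + e)) (at t within {0..})" if "t \<ge> 0"
  proof -
    have "((\<lambda>t. ln (1 + t / e)) has_real_derivative 1 / (\<bar>t\<bar> + e)) (at t within {0..})"
      using that assms
      by (auto intro!: derivative_eq_intros simp: field_simps add_pos_nonneg)
    then show ?thesis
      by (rule has_field_derivative_transform_within[OF _ zero_less_one])
        (use that in \<open>auto simp: signed_log_def\<close>)
  qed
  have left: "(signed_log e has_real_derivative 1 / (\<bar>t\<bar> + e)) (at t within {..0})" if "t \<le> 0"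
  proof -
    have "((\<lambda>t. - ln (1 - t / e)) has_real_derivative 1 / (\<bar>t\<bar> + e)) (at t within {..0})"
      using that assms
      by (auto intro!: derivative_eq_intros simp: field_simps add_pos_nonneg)
    then show ?thesis
      by (rule has_field_derivative_transform_within[OF _ zero_less_one])
        (use that in \<open>auto simp: signed_log_def\<close>)
  qed
  consider "t > 0" | "t < 0" | "t = 0" by linarith
  then show ?thesis
  proof cases
    case 1
    then have "at t within {0..} = at t"
      by (intro at_within_nhd[where S = "{0<..}"]) auto
    with 1 right show ?thesis by simp
  next
    case 2
    then have "at t within {..0} = at t"
      by (intro at_within_nhd[where S = "{..<0}"]) auto
    with 2 left show ?thesis by simp
  next
    case 3
    \<comment> \<open>Both one-sided derivatives at 0 equal \<open>1 / e\<close>, and the two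
      half-lines cover the reals.\<close>
    have "{..0} \<union> {0..} = (UNIV :: real set)" by auto
    with 3 left right show ?thesis
      unfolding has_field_derivative_iff by (metis Lim_within_Un order_refl)
  qed
qed

text \<open>The interval from \<open>- m\<close> to \<open>a - m\<close> extends at most
  \<open>a\<close> to either side of 0, and each side contributes at most
  \<open>ln (1 + a / e)\<close>.\<close>

lemma signed_log_diff_le:
  assumes "e > 0" "0 \<le> m" "m \<le> a"
  shows "signed_log e (a - m) - signed_log e (- m) \<le> 2 * ln (1 + a / e)"
proof -
  have le: "ln (1 + s / e) \<le> ln (1 + a / e)" if "0 \<le> s" "s \<le> a" for s
    using that assms by (simp add: divide_right_mono add_pos_nonneg)
  have "signed_log e (- m) = - ln (1 + m / e)"
    using assms by (cases "m = 0") (auto simp: signed_log_def)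
  then show ?thesis
    using le[of "a - m"] le[of m] assms by (simp add: signed_log_def)
qed

text \<open>Wherever \<open>m K\<close> lies in \<open>[0, a]\<close>, its summand integrates over
  that interval to at most \<open>2 * ln (1 + a / e) * \<gamma> K\<close>, so some threshold does no
  worse than the mean.\<close>

lemma exists_threshold:
  fixes \<gamma> m :: "'k \<Rightarrow> real"
  assumes "finite F" "e > 0" "a > 0"
    and \<gamma>: "\<And>K. K \<in> F \<Longrightarrow> \<gamma> K \<ge> 0"
    and m: "\<And>K. K \<in> F \<Longrightarrow> 0 \<le> m K \<and> m K \<le> a"
  shows "\<exists>\<theta>. 0 < \<theta> \<and> \<theta> < a \<and>
    a * (\<Sum>K\<in>F. \<gamma> K / (\<bar>\<theta> - m K\<bar> + e)) \<le> 2 * ln (1 + a / e) * (\<Sum>K\<in>F. \<gamma> K)"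
proof -
  define \<Phi> where "\<Phi> x = (\<Sum>K\<in>F. \<gamma> K * signed_log e (x - m K))" for x
  \<comment> \<open>The mean value theorem supplies the average over \<open>\<theta>\<close>.\<close>
  have "(\<Phi> has_real_derivative (\<Sum>K\<in>F. \<gamma> K / (\<bar>x - m K\<bar> + e))) (at x)" for x
  proof -
    have "((\<lambda>x. signed_log e (x - m K)) has_real_derivative 1 / (\<bar>x - m K\<bar> + e)) (at x)" for K
      using DERIV_chain2[where g = "\<lambda>x. x - m K" and x = x,
          OF DERIV_signed_log[OF \<open>e > 0\<close>] DERIV_diff[OF DERIV_ident DERIV_const]]
      by simp
    from DERIV_cmult[OF this]
    have "((\<lambda>x. \<gamma> K * signed_log e (x - m K)) has_real_derivative \<gamma> K / (\<bar>x - m K\<bar> + e)) (at x)" for K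
      by simp
    then show ?thesis
      unfolding \<Phi>_def by (rule DERIV_sum)
  qed
  from MVT2[OF \<open>a > 0\<close> this] obtain \<theta> where \<theta>: "0 < \<theta>" "\<theta> < a"
    and eq: "\<Phi> a - \<Phi> 0 = (a - 0) * (\<Sum>K\<in>F. \<gamma> K / (\<bar>\<theta> - m K\<bar> + e))"
    by blast
  have "\<Phi> a - \<Phi> 0 = (\<Sum>K\<in>F. \<gamma> K * (signed_log e (a - m K) - signed_log e (- m K)))"
    by (simp add: \<Phi>_def sum_subtractf algebra_simps)
  also have "\<dots> \<le> (\<Sum>K\<in>F. \<gamma> K * (2 * ln (1 + a / e)))"
    by (intro sum_mono mult_left_mono signed_log_diff_le) (use assms in auto)
  also have "\<dots> = 2 * ln (1 + a / e) * (\<Sum>K\<in>F. \<gamma> K)"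
    by (simp only: sum_distrib_right mult.commute)
  finally show ?thesis
    using \<theta> eq by auto
qed

section \<open>Distance potentials and threshold cuts\<close>

text \<open>The potential is the vertex-weighted distance from \<open>A\<close>, end vertices
  included, capped at \<open>c\<close>. By \<open>heavy\<close> the distance to \<open>B\<close> is
  at least \<open>c\<close>, so the cap makes it constant there.\<close>

lemma exists_potential:
  fixes G :: "('a, 'b) pre_digraph" and \<omega> :: "'a \<Rightarrow> real"
  assumes "A \<subseteq> verts G" and "wf_digraph G" and \<omega>: "\<And>v. \<omega> v \<ge> 0" and "c \<ge> 0"
    and heavy: "\<And>p. AB_path G A B p \<Longrightarrow> c \<le> (\<Sum>v\<in>set p. \<omega> v)"
  obtains d where "\<And>v. 0 \<le> d v" "\<And>v. d v \<le> c" "\<And>v. v \<in> A \<Longrightarrow> d v \<le> \<omega> v"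
    "\<And>u v. u \<rightarrow>\<^bsub>G\<^esub> v \<Longrightarrow> d v \<le> d u + \<omega> v" "\<And>v. v \<in> B \<Longrightarrow> d v = c"
proof
  \<comment> \<open>Inserting \<open>c\<close> caps the infimum and keeps the set nonempty for
    unreachable vertices. Summing over \<open>set p\<close> counts a repeated vertex once, so
    appending \<open>v\<close> to a walk costs at most \<open>\<omega> v\<close>.\<close>
  define D where
    "D v = insert c ((\<lambda>p. \<Sum>x\<in>set p. \<omega> x) ` {p. vwalk p G \<and> hd p \<in> A \<and> last p = v})" for v
  define d where "d v = Inf (D v)" for v
  have pos: "0 \<le> x" if "x \<in> D v" for x v
    using that \<open>c \<ge> 0\<close> \<omega> by (auto simp: D_def intro: sum_nonneg)
  then have bdd: "bdd_below (D v)" for v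
    by (meson bdd_belowI)
  have ne: "D v \<noteq> {}" for v by (simp add: D_def)
  have lower: "d v \<le> x" if "x \<in> D v" for x v
    unfolding d_def using that bdd by (rule cInf_lower)
  show "0 \<le> d v" for v
    unfolding d_def using ne pos by (rule cInf_greatest)
  show dc: "d v \<le> c" for v
    by (rule lower) (simp add: D_def)
  show "d v \<le> \<omega> v" if "v \<in> A" for v
  proof -
    have "vwalk [v] G" using that \<open>A \<subseteq> verts G\<close> by (auto simp: vwalk_def)
    then show ?thesis
      using that by (intro lower) (auto simp: D_def intro!: image_eqI[where x = "[v]"])
  qed
  show "d v \<le> d u + \<omega> v" if uv: "u \<rightarrow>\<^bsub>G\<^esub> v" for u v
  proof -
    have "d v - \<omega> v \<le> x" if "x \<in> D u" for x
      using that unfolding D_def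
    proof safe
      show "d v - \<omega> v \<le> c" using dc[of v] \<omega>[of v] by linarith
    next
      fix p assume p: "vwalk p G" "hd p \<in> A" "u = last p"
      then have "p \<noteq> []" by auto
      have "vwalk (p @ [v]) G"
        using p uv \<open>p \<noteq> []\<close> wf_digraph.adj_in_verts(2)[OF \<open>wf_digraph G\<close> uv]
        by (auto simp: vwalk_def set_vwalk_arcs_snoc)
      with p \<open>p \<noteq> []\<close> have "(\<Sum>x\<in>set (p @ [v]). \<omega> x) \<in> D v"
        unfolding D_def by (intro insertI2 imageI) auto
      from lower[OF this] show "d v - \<omega> v \<le> (\<Sum>x\<in>set p. \<omega> x)"
        using \<omega>[of v] by (cases "v \<in> set p") (auto simp: insert_absorb)
    qed
    then have "d v - \<omega> v \<le> d u"
      unfolding d_def[of u] using ne by (intro cInf_greatest)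
    then show ?thesis by simp
  qed
  show "d v = c" if "v \<in> B" for v
  proof (rule antisym[OF dc])
    have "c \<le> x" if "x \<in> D v" for x
      using that unfolding D_def
    proof safe
      fix p assume p: "vwalk p G" "hd p \<in> A" "v = last p"
      \<comment> \<open>\<open>heavy\<close> speaks of paths only; shortcutting the walk keeps its
        ends and adds no vertices.\<close>
      let ?q = "vwalk_to_vpath p"
      have "AB_path G A B ?q"
        using p \<open>v \<in> B\<close>
        by (auto simp: AB_path_def vwalk_to_vpath_hd vwalk_to_vpath_last intro: vwalk_to_vpath_vpath)
      then have "c \<le> (\<Sum>x\<in>set ?q. \<omega> x)" by (rule heavy)
      also have "\<dots> \<le> (\<Sum>x\<in>set p. \<omega> x)"
        using \<omega> by (intro sum_mono2) (auto dest: vwalk_to_vpath_subset)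
      finally show "c \<le> (\<Sum>x\<in>set p. \<omega> x)" .
    qed
    then show "c \<le> d v"
      unfolding d_def using ne by (intro cInf_greatest)
  qed
qed

text \<open>The first vertex \<open>v\<close> with \<open>\<theta> \<le> d v\<close> works: it is
  the head, or its predecessor \<open>u\<close> has \<open>d u < \<theta>\<close> and
  \<open>step\<close> applies.\<close>

lemma walk_crosses_threshold:
  fixes d \<omega> :: "'a \<Rightarrow> real"
  assumes "vwalk p G" "d (hd p) - \<omega> (hd p) < \<theta>" "\<theta> \<le> d (last p)"
    and step: "\<And>u v. u \<rightarrow>\<^bsub>G\<^esub> v \<Longrightarrow> d v \<le> d u + \<omega> v"
  shows "\<exists>v\<in>set p. d v - \<omega> v < \<theta> \<and> \<theta> \<le> d v"
  using assms(1-3)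
proof (induction p rule: vwalk_induct)
  case (Base u)
  then show ?case by auto
next
  case (Cons u v es)
  show ?case
  proof (cases "\<theta> \<le> d u")
    case True
    with Cons show ?thesis by auto
  next
    case False
    with step[OF Cons.hyps(1)] have "d v - \<omega> v < \<theta>" by simp
    with Cons show ?thesis by auto
  qed
qed

text \<open>Scaled masses may exceed 1, which \<open>fractional_cover\<close> forbids. Capping them
  is harmless, since one clique of value 1 covers all its vertices.\<close>

lemma rho_star_le_truncated:
  fixes \<gamma> :: "'a set \<Rightarrow> real"
  assumes "finite F" and \<gamma>: "\<And>K. K \<in> F \<Longrightarrow> \<gamma> K \<ge> 0"
    and cover: "\<And>v. v \<in> X \<Longrightarrow> 1 \<le> (\<Sum>K | K \<in> F \<and> v \<in> K. \<gamma> K)"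
    and "(\<Sum>K\<in>F. \<gamma> K) \<le> r"
  shows "rho_star F X \<le> ereal r"
proof -
  let ?\<gamma> = "\<lambda>K. min 1 (\<gamma> K)"
  have "1 \<le> (\<Sum>K | K \<in> F \<and> v \<in> K. ?\<gamma> K)" if "v \<in> X" for v
  proof (cases "\<exists>K\<in>F. v \<in> K \<and> \<gamma> K \<ge> 1")
    case True
    then obtain K where K: "K \<in> F" "v \<in> K" "\<gamma> K \<ge> 1" by blast
    then have "1 = ?\<gamma> K" by simp
    also have "\<dots> \<le> (\<Sum>K | K \<in> F \<and> v \<in> K. ?\<gamma> K)"
      using K \<gamma> \<open>finite F\<close> by (intro member_le_sum) auto
    finally show ?thesis .
  next
    case False
    then have "(\<Sum>K | K \<in> F \<and> v \<in> K. ?\<gamma> K) = (\<Sum>K | K \<in> F \<and> v \<in> K. \<gamma> K)"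
      by (intro sum.cong) auto
    with cover[OF that] show ?thesis by simp
  qed
  then have "fractional_cover F X ?\<gamma>"
    using \<gamma> by (auto simp: fractional_cover_def)
  then have "rho_star F X \<le> ereal (\<Sum>K\<in>F. ?\<gamma> K)"
    unfolding rho_star_def by (intro Inf_lower) blast
  also have "\<dots> \<le> ereal (\<Sum>K\<in>F. \<gamma> K)"
    by (simp add: sum_mono)
  finally show ?thesis
    using assms(4) by (meson ereal_less_eq(3) order_trans)
qed

text \<open>In \<open>cut\<close> a path pays once for each clique it meets; passing to vertex
  weights, which pay once per vertex, makes distances available.\<close>

lemma separator_of_fractional_clique_cut:
  fixes G :: "('a, 'b) pre_digraph" and \<gamma> :: "'a set \<Rightarrow> real"
  assumes "graph G" and n: "card (verts G) = n" "n > 0"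
    and "A \<subseteq> verts G"
    and cl: "\<And>K. K \<in> F \<Longrightarrow> clique G K" and "finite F"
    and \<gamma>: "\<And>K. K \<in> F \<Longrightarrow> \<gamma> K \<ge> 0"
    and cut: "\<And>p. AB_path G A B p \<Longrightarrow> 1 \<le> (\<Sum>K\<in>{K\<in>F. set p \<inter> K \<noteq> {}}. \<gamma> K)"
  shows "\<exists>X. AB_separator G A B X \<and> rho_star F X \<le> ereal (4 * ln (1 + real n) * (\<Sum>K\<in>F. \<gamma> K))"
proof -
  interpret graph G by fact
  define \<omega> where "\<omega> v = (\<Sum>K | K \<in> F \<and> v \<in> K. \<gamma> K)" for v
  define e where "e = 1 / (2 * real n)"
  have "e > 0" using n by (simp add: e_def)
  \<comment> \<open>Lowering all weights by \<open>e\<close> costs a path at most \<open>n * e = 1/2\<close>, and then \<open>\<omega> \<ge> \<bar>\<theta> - m\<bar> + e\<close>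
    on the separator, which removes the singularity at \<open>\<theta> = m\<close>.\<close>
  define \<omega>' where "\<omega>' v = max 0 (\<omega> v - e)" for v
  have \<omega>'_nonneg: "\<omega>' v \<ge> 0" for v by (simp add: \<omega>'_def)
  have heavy: "1 / 2 \<le> (\<Sum>v\<in>set p. \<omega>' v)" if p: "AB_path G A B p" for p
  proof -
    have "set p \<subseteq> verts G" using p by (auto simp: AB_path_def)
    then have "card (set p) \<le> n" using n by (metis card_mono finite_verts)
    then have "real (card (set p)) * e \<le> 1 / 2"
      using n by (simp add: e_def field_simps)
    \<comment> \<open>Each clique that is met is charged to its vertices on \<open>p\<close>, at
      least one; swapping the sums then gives \<open>\<omega>\<close>.\<close>
    have "(\<Sum>K\<in>{K\<in>F. set p \<inter> K \<noteq> {}}. \<gamma> K) \<le> (\<Sum>K\<in>F. \<Sum>v\<in>{v\<in>set p. v \<in> K}. \<gamma> K)"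
    proof -
      have "\<gamma> K \<le> (\<Sum>v\<in>{v\<in>set p. v \<in> K}. \<gamma> K)" if "K \<in> F" "set p \<inter> K \<noteq> {}" for K
      proof -
        from that(2) obtain v where "v \<in> {v\<in>set p. v \<in> K}" by blast
        then show ?thesis
          using member_le_sum[of v "{v\<in>set p. v \<in> K}" "\<lambda>_. \<gamma> K"] \<gamma>[OF that(1)] by simp
      qed
      then have "(\<Sum>K\<in>{K\<in>F. set p \<inter> K \<noteq> {}}. \<gamma> K)
          \<le> (\<Sum>K\<in>{K\<in>F. set p \<inter> K \<noteq> {}}. \<Sum>v\<in>{v\<in>set p. v \<in> K}. \<gamma> K)"
        by (intro sum_mono) auto
      also have "\<dots> \<le> (\<Sum>K\<in>F. \<Sum>v\<in>{v\<in>set p. v \<in> K}. \<gamma> K)"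
        using \<gamma> \<open>finite F\<close> by (intro sum_mono2 sum_nonneg) auto
      finally show ?thesis .
    qed
    also have "\<dots> = (\<Sum>v\<in>set p. \<omega> v)"
      unfolding \<omega>_def by (rule sum.swap_restrict) (use \<open>finite F\<close> in auto)
    finally have "1 \<le> (\<Sum>v\<in>set p. \<omega> v)" using cut[OF p] by simp
    also have "\<dots> \<le> (\<Sum>v\<in>set p. \<omega>' v + e)"
      by (intro sum_mono) (simp add: \<omega>'_def)
    also have "\<dots> = (\<Sum>v\<in>set p. \<omega>' v) + real (card (set p)) * e"
      by (simp add: sum.distrib)
    finally show ?thesis
      using \<open>real (card (set p)) * e \<le> 1 / 2\<close> by simp
  qed
  obtain d where d: "\<And>v. 0 \<le> d v" "\<And>v. d v \<le> 1 / 2" "\<And>v. v \<in> A \<Longrightarrow> d v \<le> \<omega>' v"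
    "\<And>u v. u \<rightarrow>\<^bsub>G\<^esub> v \<Longrightarrow> d v \<le> d u + \<omega>' v" "\<And>v. v \<in> B \<Longrightarrow> d v = 1 / 2"
    by (rule exists_potential[OF \<open>A \<subseteq> verts G\<close> wf_digraph_axioms, of \<omega>' "1 / 2" B])
      (use \<omega>'_nonneg heavy in auto)
  \<comment> \<open>Adjacency within the clique enters here: every other vertex is one arc from a
    minimizer of \<open>d\<close>. For an empty clique the value 0 is arbitrary.\<close>
  have "\<exists>m. 0 \<le> m \<and> m \<le> 1 / 2 \<and> (\<forall>v\<in>K. d v - \<omega>' v \<le> m \<and> m \<le> d v)" if "K \<in> F" for K
  proof (cases "K = {}")
    case True
    then show ?thesis by (intro exI[of _ 0]) auto
  next
    case False
    have K: "K \<subseteq> verts G" "\<And>u v. u \<in> K \<Longrightarrow> v \<in> K \<Longrightarrow> u \<noteq> v \<Longrightarrow> u \<rightarrow>\<^bsub>G\<^esub> v"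
      using cl[OF that] by (auto simp: clique_def)
    then have "finite K" using finite_verts finite_subset by blast
    with False obtain u where u: "u \<in> K" "\<And>v. v \<in> K \<Longrightarrow> d u \<le> d v"
      by (metis arg_min_if_finite(1) arg_min_least)
    have "d v - \<omega>' v \<le> d u" if "v \<in> K" for v
      using d(4)[OF K(2), of u v] that u(1) \<omega>'_nonneg[of v] by (cases "u = v") auto
    with u d show ?thesis by (intro exI[of _ "d u"]) auto
  qed
  then obtain m where m: "\<And>K. K \<in> F \<Longrightarrow> 0 \<le> m K \<and> m K \<le> 1 / 2"
    "\<And>K v. K \<in> F \<Longrightarrow> v \<in> K \<Longrightarrow> d v - \<omega>' v \<le> m K \<and> m K \<le> d v"
    by metis
  \<comment> \<open>With \<open>a = 1 / 2\<close> the quotient \<open>a / e\<close> is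
    \<open>n\<close>, and dividing by \<open>a\<close> turns the factor 2 into 4.\<close>
  obtain \<theta> where \<theta>: "0 < \<theta>" "\<theta> < 1 / 2"
    and cost: "1 / 2 * (\<Sum>K\<in>F. \<gamma> K / (\<bar>\<theta> - m K\<bar> + e)) \<le> 2 * ln (1 + (1 / 2) / e) * (\<Sum>K\<in>F. \<gamma> K)"
    using exists_threshold[of F e "1/2" \<gamma> m] \<open>finite F\<close> \<open>e > 0\<close> \<gamma> m(1) by auto
  define X where "X = {v \<in> verts G. d v - \<omega>' v < \<theta> \<and> \<theta> \<le> d v}"
  have "AB_separator G A B X"
    unfolding AB_separator_def
  proof (intro conjI allI impI)
    show "X \<subseteq> verts G" by (auto simp: X_def)
    fix p assume "AB_path G A B p"
    then have p: "vwalk p G" "hd p \<in> A" "last p \<in> B" by (auto simp: AB_path_def)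
    have "\<exists>v\<in>set p. d v - \<omega>' v < \<theta> \<and> \<theta> \<le> d v"
      by (rule walk_crosses_threshold[OF p(1)]) (use d(3)[OF p(2)] d(5)[OF p(3)] d(4) \<theta> in auto)
    then show "set p \<inter> X \<noteq> {}"
      using p(1) by (auto simp: X_def)
  qed
  moreover have "rho_star F X \<le> ereal (4 * ln (1 + real n) * (\<Sum>K\<in>F. \<gamma> K))"
  proof (rule rho_star_le_truncated)
    show "\<gamma> K / (\<bar>\<theta> - m K\<bar> + e) \<ge> 0" if "K \<in> F" for K
      using \<gamma>[OF that] \<open>e > 0\<close> by simp
    show "1 \<le> (\<Sum>K | K \<in> F \<and> v \<in> K. \<gamma> K / (\<bar>\<theta> - m K\<bar> + e))" if "v \<in> X" for v
    proof -
      have v: "d v - \<omega>' v < \<theta>" "\<theta> \<le> d v" using that by (auto simp: X_def)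
      \<comment> \<open>\<open>v\<close> gives \<open>\<omega>' v > 0\<close>, so the truncation at
        0 is inactive. Both \<open>\<theta>\<close> and \<open>m K\<close> lie in an interval of
        length \<open>\<omega> v - e\<close>, so the denominators below are at most
        \<open>\<omega> v\<close>.\<close>
      then have \<omega>'_eq: "\<omega>' v = \<omega> v - e" and "\<omega> v > 0"
        using \<open>e > 0\<close> by (auto simp: \<omega>'_def max_def split: if_splits)
      have "1 = (\<Sum>K | K \<in> F \<and> v \<in> K. \<gamma> K / \<omega> v)"
        using \<open>\<omega> v > 0\<close> by (simp add: \<omega>_def flip: sum_divide_distrib)
      also have "\<dots> \<le> (\<Sum>K | K \<in> F \<and> v \<in> K. \<gamma> K / (\<bar>\<theta> - m K\<bar> + e))"
      proof (intro sum_mono divide_left_mono)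
        fix K assume "K \<in> {K. K \<in> F \<and> v \<in> K}"
        then have "d v - \<omega>' v \<le> m K" "m K \<le> d v" using m(2) by auto
        with v \<omega>'_eq show "\<bar>\<theta> - m K\<bar> + e \<le> \<omega> v" by (simp add: abs_if)
      qed (use \<gamma> \<open>e > 0\<close> \<open>\<omega> v > 0\<close> in auto)
      finally show ?thesis .
    qed
    show "(\<Sum>K\<in>F. \<gamma> K / (\<bar>\<theta> - m K\<bar> + e)) \<le> 4 * ln (1 + real n) * (\<Sum>K\<in>F. \<gamma> K)"
      using cost by (simp add: e_def)
  qed (fact \<open>finite F\<close>)
  ultimately show ?thesis by blast
qed

text \<open>With \<open>card F = 1\<close> the load bound would be 0, so the second alternative
  would fail; for \<open>F = {{}}\<close> and \<open>A \<inter> B\<close> nonempty the first fails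
  too, as no separator can be covered.\<close>

theorem theorem1p4:
  fixes G :: "('a, 'b) pre_digraph"
    and A B :: "'a set"
    and F :: "'a set set"
    and f :: real
    and n :: nat
  assumes "graph G"
    and "card (verts G) = n"
    and "A \<subseteq> verts G" and "B \<subseteq> verts G"
    and "\<And>K. K \<in> F \<Longrightarrow> clique G K"
    and "card F \<noteq> 1"
    and "f > 0"
  shows "(\<exists>X. AB_separator G A B X \<and> rho_star F X \<le> ereal ((8 + 4 * ln (real n)) * f)) \<or>
    (\<exists>P :: nat \<Rightarrow> 'a vwalk.
       (\<forall>i\<in>{1..nat \<lceil>f * log 2 (real (card F))\<rceil>}. AB_path G A B (P i)) \<and>
       \<not> (\<exists>K\<in>F. real (card {i \<in> {1..nat \<lceil>f * log 2 (real (card F))\<rceil>}. set (P i) \<inter> K \<noteq> {}})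
                   \<ge> 6 * log 2 (real (card F))))"
    (is "?sep \<or> ?paths")
proof -
  interpret graph G by fact
  have F: "K \<subseteq> verts G" if "K \<in> F" for K
    using assms(5)[OF that] by (simp add: clique_def)
  then have "finite F"
    by (intro finite_subset[of F "Pow (verts G)"]) auto
  define N where "N = nat \<lceil>f * log 2 (real (card F))\<rceil>"
  show ?thesis
  proof (cases "F = {}")
    \<comment> \<open>Here \<open>log 2 0 = 0\<close>, so zero paths are requested and the second
      alternative is vacuous.\<close>
    case True
    then show ?thesis by (simp add: log_def)
  next
    case False
    with \<open>card F \<noteq> 1\<close> \<open>finite F\<close> have k: "card F \<ge> 2"
      by (metis One_nat_def Suc_leI card_gt_0_iff le_neq_implies_less numeral_2_eq_2)
    \<comment> \<open>The only clique of an empty graph is \<open>{}\<close>, while \<open>F\<close>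
      has two members.\<close>
    have "verts G \<noteq> {}"
    proof
      assume "verts G = {}"
      with F have "F \<subseteq> {{}}" by auto
      with card_mono[of "{{}}" F] k show False by simp
    qed
    with assms(2) have "n > 0" by (auto simp: card_gt_0_iff)
    show ?thesis
    proof (cases "\<forall>w :: 'a set \<Rightarrow> real. (\<forall>K\<in>F. w K > 0) \<longrightarrow>
        (\<exists>p. AB_path G A B p \<and> f * (\<Sum>K\<in>{K\<in>F. set p \<inter> K \<noteq> {}}. w K) \<le> (\<Sum>K\<in>F. w K))")
      case True
      then obtain P where P: "\<And>i. i \<in> {1..N} \<Longrightarrow> AB_path G A B (P i)"
        and pot: "(\<Sum>K\<in>F. (2::real) ^ card {i\<in>{1..N}. set (P i) \<inter> K \<noteq> {}})
          \<le> real (card F) * (1 + 1 / f) ^ N"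
        using greedy_balanced_sequence[OF \<open>finite F\<close> \<open>f > 0\<close>,
          of "AB_path G A B" "\<lambda>p K. set p \<inter> K \<noteq> {}" N] by blast
      have "real (card {i\<in>{1..N}. set (P i) \<inter> K \<noteq> {}}) < 6 * log 2 (real (card F))" if "K \<in> F" for K
      proof (rule load_less_of_potential[OF \<open>f > 0\<close> k N_def])
        show "card {i\<in>{1..N}. set (P i) \<inter> K \<noteq> {}} \<le> N"
          by (rule order_trans[OF card_mono[of "{1..N}"]]) auto
        have "(2::real) ^ card {i\<in>{1..N}. set (P i) \<inter> K \<noteq> {}}
            \<le> (\<Sum>K\<in>F. (2::real) ^ card {i\<in>{1..N}. set (P i) \<inter> K \<noteq> {}})"
          using \<open>finite F\<close> that
          by (intro member_le_sum[where f = "\<lambda>K. (2::real) ^ card {i\<in>{1..N}. set (P i) \<inter> K \<noteq> {}}"]) auto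
        with pot show "(2::real) ^ card {i\<in>{1..N}. set (P i) \<inter> K \<noteq> {}} \<le> real (card F) * (1 + 1 / f) ^ N"
          by linarith
      qed
      with P have ?paths
        unfolding N_def[symmetric] by (intro exI[of _ P]) (auto simp: not_le)
      then show ?thesis ..
    next
      case False
      then obtain w :: "'a set \<Rightarrow> real" where w: "\<And>K. K \<in> F \<Longrightarrow> w K > 0"
        and cut: "\<And>p. AB_path G A B p \<Longrightarrow> (\<Sum>K\<in>F. w K) < f * (\<Sum>K\<in>{K\<in>F. set p \<inter> K \<noteq> {}}. w K)"
        by (auto simp: not_le)
      define W where "W = (\<Sum>K\<in>F. w K)"
      have "W > 0"
        unfolding W_def using \<open>finite F\<close> \<open>F \<noteq> {}\<close> w by (rule sum_pos)
      define \<gamma> where "\<gamma> K = f * w K / W" for K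
      have sum_\<gamma>: "(\<Sum>K\<in>S. \<gamma> K) = f * (\<Sum>K\<in>S. w K) / W" for S
        by (simp add: \<gamma>_def sum_distrib_left sum_divide_distrib)
      obtain X where X: "AB_separator G A B X" "rho_star F X \<le> ereal (4 * ln (1 + real n) * (\<Sum>K\<in>F. \<gamma> K))"
      proof (atomize_elim, rule separator_of_fractional_clique_cut)
        show "\<gamma> K \<ge> 0" if "K \<in> F" for K
          using w[OF that] \<open>W > 0\<close> \<open>f > 0\<close> by (simp add: \<gamma>_def)
        show "1 \<le> (\<Sum>K\<in>{K\<in>F. set p \<inter> K \<noteq> {}}. \<gamma> K)" if "AB_path G A B p" for p
          using cut[OF that] \<open>W > 0\<close> unfolding sum_\<gamma> W_def[symmetric] by simp
      qed (use assms \<open>n > 0\<close> \<open>finite F\<close> in auto)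
      have "(\<Sum>K\<in>F. \<gamma> K) = f"
        using \<open>W > 0\<close> by (simp add: sum_\<gamma> flip: W_def)
      with X(2) have "rho_star F X \<le> ereal (4 * ln (1 + real n) * f)"
        by simp
      also have "ereal (4 * ln (1 + real n) * f) \<le> ereal ((8 + 4 * ln (real n)) * f)"
      proof (rule ereal_less_eq(3)[THEN iffD2], rule mult_right_mono)
        \<comment> \<open>As \<open>ln 2 \<le> 1\<close>, replacing \<open>1 + n\<close> by
          \<open>2 * n\<close> costs at most 4 of the additive 8.\<close>
        have "ln (1 + real n) \<le> ln (2 * real n)"
          using \<open>n > 0\<close> by simp
        also have "\<dots> = ln 2 + ln (real n)"
          using \<open>n > 0\<close> by (simp add: ln_mult)
        finally show "4 * ln (1 + real n) \<le> 8 + 4 * ln (real n)"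
          using ln_le_minus_one[of 2] by simp
      qed (use \<open>f > 0\<close> in simp)
      finally have ?sep
        using X(1) by blast
      then show ?thesis ..
    qed
  qed
qed

end
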